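(* There is a $\sqsubseteq$-antichain of cardinality $\mathfrak{c}$ consisting of ideals each of which is both an Erdős–Ulam ideal and a simple density ideal.
   Context: $\omega=\{0,1,2,\ldots\}$ and $n\in\omega$ is identified with $\{0,\ldots,n-1\}$; $\mathfrak{c}$ is the cardinality of the continuum. An ideal on $\omega$ is a family of subsets of $\omega$ closed under finite unions and subsets, which is a proper subset of the power set of $\omega$ and contains all finite subsets of $\omega$. A simple density ideal is an ideal of the form $\mathcal{Z}_g=\{A\subseteq\omega:\lim_{n\to\infty}\frac{\mathrm{card}(A\cap n)}{g(n)}=0\}$, where $g\colon\omega\to[0,\infty)$ satisfies $\lim_{n\to\infty}g(n)=\infty$ and $\frac{n}{g(n)}$ does not converge to $0$. An Erdős–Ulam ideal is an ideal of the form $\mathcal{EU}_f=\{A\subseteq\omega:\lim_{n\to\infty}\frac{\sum_{i\in A\cap n}f(i)}{\sum_{i=0}^{n-1}f(i)}=0\}$, where $f\colon\omega\to[0,\infty)$ satisfies $\sum_{i=0}^\infty f(i)=\infty$ and $\lim_{n\to\infty}\frac{f(n)}{\sum_{i=0}^nf(i)}=0$. $\mathcal{I}\sqsubseteq\mathcal{J}$ means that there is a bijection $\phi\colon\omega\to\omega$ such that $A\in\mathcal{I}$ implies $\phi^{-1}[A]\in\mathcal{J}$ for all $A\subseteq\omega$. A family $\mathcal{F}$ of ideals is a $\sqsubseteq$-antichain if $\mathcal{I}\not\sqsubseteq\mathcal{J}$ and $\mathcal{J}\not\sqsubseteq\mathcal{I}$ for every pair of distinct ideals $\mathcal{I},\mathcal{J}\in\mathcal{F}$.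 *)

theory Defs
  imports Complex_Main "HOL-Library.Equipollence"
begin

definition ideal_on_nat :: "nat set set \<Rightarrow> bool" where
  "ideal_on_nat I \<longleftrightarrow>
     (\<forall>A\<in>I. \<forall>B\<in>I. A \<union> B \<in> I) \<and>
     (\<forall>A\<in>I. \<forall>B. B \<subseteq> A \<longrightarrow> B \<in> I) \<and>
     I \<noteq> UNIV \<and>
     (\<forall>A. finite A \<longrightarrow> A \<in> I)"

text \<open>
  In the two quotients defining the ideals below the denominators tend to infinity whenever
  the side conditions hold, so the convention \<open>x / 0 = 0\<close> affects only finitely many
  terms and has no influence on the limits. The natural number \<open>n\<close>, viewed as a set,
  is \<open>{..<n}\<close>.
\<close>

definition simple_density_family :: "(nat \<Rightarrow> real) \<Rightarrow> nat set set" where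
  "simple_density_family g =
     {A. (\<lambda>n. real (card (A \<inter> {..<n})) / g n) \<longlonglongrightarrow> 0}"

definition simple_density_ideal :: "nat set set \<Rightarrow> bool" where
  "simple_density_ideal I \<longleftrightarrow>
     ideal_on_nat I \<and>
     (\<exists>g :: nat \<Rightarrow> real.
        (\<forall>n. 0 \<le> g n) \<and>
        filterlim g at_top sequentially \<and>
        \<not> (\<lambda>n. real n / g n) \<longlonglongrightarrow> 0 \<and>
        I = simple_density_family g)"

definition erdos_ulam_family :: "(nat \<Rightarrow> real) \<Rightarrow> nat set set" where
  "erdos_ulam_family f =
     {A. (\<lambda>n. (\<Sum>i\<in>A \<inter> {..<n}. f i) / (\<Sum>i<n. f i)) \<longlonglongrightarrow> 0}"

definition erdos_ulam_ideal :: "nat set set \<Rightarrow> bool" where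
  "erdos_ulam_ideal I \<longleftrightarrow>
     ideal_on_nat I \<and>
     (\<exists>f :: nat \<Rightarrow> real.
        (\<forall>n. 0 \<le> f n) \<and>
        filterlim (\<lambda>n. \<Sum>i<n. f i) at_top sequentially \<and>
        (\<lambda>n. f n / (\<Sum>i\<le>n. f i)) \<longlonglongrightarrow> 0 \<and>
        I = erdos_ulam_family f)"

definition ideal_below :: "nat set set \<Rightarrow> nat set set \<Rightarrow> bool" where
  "ideal_below I J \<longleftrightarrow>
     (\<exists>\<phi> :: nat \<Rightarrow> nat. bij \<phi> \<and> (\<forall>A. A \<in> I \<longrightarrow> \<phi> -` A \<in> J))"

definition ideal_antichain :: "nat set set set \<Rightarrow> bool" where
  "ideal_antichain F \<longleftrightarrow>
     (\<forall>I\<in>F. ideal_on_nat I) \<and>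
     (\<forall>I\<in>F. \<forall>J\<in>F. I \<noteq> J \<longrightarrow> \<not> ideal_below I J \<and> \<not> ideal_below J I)"

end

theory Submission
  imports Defs
begin

text \<open>
  For a sequence \<open>N\<close> of positive integers let \<open>null_along N\<close> consist of the sets whose density
  in the initial segment \<open>{..<N k}\<close> tends to \<open>0\<close> as \<open>k \<rightarrow> \<infinity>\<close>. The members of the antichain are
  ideals of this form, with every \<open>N k\<close> a factorial.

  If \<open>N\<close> at least doubles in each step, \<open>null_along N\<close> is an ideal of both kinds. It is the simple
  density ideal of the step function \<open>g\<close> sending \<open>n\<close> to the first \<open>N k \<ge> n\<close>: the quotient
  \<open>card (A \<inter> {..<n}) / g n\<close> is at most the density at this \<open>k\<close>, with equality for \<open>n = N k\<close>
  (\<open>simple_density_null_along\<close>). It is also the Erdos-Ulam ideal of the weight that equals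
  \<open>2 ^ k / N k\<close> on the \<open>k\<close>-th block \<open>{N (k - 1)..<N k}\<close>. Up to bounded factors the \<open>k\<close>-th block
  then has total mass \<open>2 ^ k\<close>, as much as all blocks up to the \<open>k\<close>-th together, so the relative
  mass of \<open>A\<close> up to \<open>N k\<close> controls its density at \<open>k\<close>; conversely it is controlled by a
  geometrically damped average of the densities at \<open>0, \<dots>, k\<close>, which tends to \<open>0\<close> when they do
  (\<open>erdos_ulam_null_along\<close>).

  Two such ideals with \<open>N k = fact (a k)\<close> and \<open>M k = fact (b k)\<close> are incomparable as soon as the
  strictly increasing sequences \<open>a\<close> and \<open>b\<close> have only finitely many values in common (\<open>not_ideal_below_factorials\<close>). Consecutive
  factorials have ratios tending to infinity, so at a scale \<open>fact (b k)\<close> that is none of the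
  \<open>fact (a l)\<close> an injection must send almost all of \<open>{..<fact (b k)}\<close> to positions
  where only such \<open>fact (a l)\<close> matter that are far larger than \<open>fact (b k)\<close>. Collecting these
  images over all \<open>k\<close> gives a set that is small along \<open>fact \<circ> a\<close> and whose preimage is large along \<open>fact \<circ> b\<close>.

  Continuum many pairwise almost disjoint sequences are provided by the base-4 expansions: to a real
  \<open>r\<close> with \<open>1 < r < 2\<close> belongs the sequence of the numbers \<open>\<lfloor>4 ^ k * r\<rfloor>\<close>
  (\<open>eventually_base4_prefix_notin_range\<close>).
\<close>

section \<open>Null sequences\<close>

lemma filterlim_const_mult_power:
  fixes c x :: real
  assumes "0 < c" "1 < x"
  shows "filterlim (\<lambda>n. c * x ^ n) at_top sequentially"
proof (rule filterlim_tendsto_pos_mult_at_top [OF tendsto_const \<open>0 < c\<close>])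
  have "filterlim (\<lambda>n. x ^ n) at_infinity sequentially"
    using \<open>1 < x\<close> by (intro filterlim_realpow_sequentially_gt1) simp
  then show "filterlim (\<lambda>n. x ^ n) at_top sequentially"
    using \<open>1 < x\<close> by (intro filterlim_at_infinity_imp_filterlim_at_top) auto
qed

lemma tendsto_0_squeeze:
  fixes f g :: "nat \<Rightarrow> real"
  assumes "g \<longlonglongrightarrow> 0" and "\<And>n. 0 \<le> f n" and "eventually (\<lambda>n. f n \<le> g n) sequentially"
  shows "f \<longlonglongrightarrow> 0"
  using assms by (intro tendsto_sandwich [of "\<lambda>_. 0" f _ g]) auto

text \<open>
  Unfolding the recursion shows that \<open>u k\<close> is bounded by the damped average
  \<open>d k + d (k - 1) / 2 + d (k - 2) / 4 + \<dots>\<close>. Once all \<open>d k\<close> are below \<open>e / 4\<close> this part contributes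
  at most \<open>e / 2\<close>, and what remains is an initial value halved in each step.
\<close>

lemma tendsto_0_by_halving_recursion:
  fixes u d :: "nat \<Rightarrow> real"
  assumes nonneg: "\<And>k. 0 \<le> u k"
    and step: "\<And>k. u (Suc k) \<le> u k / 2 + d (Suc k)"
    and d: "d \<longlonglongrightarrow> 0"
  shows "u \<longlonglongrightarrow> 0"
proof (rule LIMSEQ_I)
  fix e :: real assume e: "0 < e"
  obtain K where K: "\<And>k. k \<ge> K \<Longrightarrow> \<bar>d k\<bar> < e / 4"
    using LIMSEQ_D [OF d, of "e / 4"] e by auto
  have tail: "u (K + j) \<le> u K / 2 ^ j + e / 2" for j
  proof (induction j)
    case 0
    then show ?case using e by simp
  next
    case (Suc j)
    have "u (K + Suc j) \<le> u (K + j) / 2 + e / 4"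
      using step [of "K + j"] K [of "Suc (K + j)"] by auto
    moreover have "u (K + j) / 2 \<le> u K / 2 ^ Suc j + e / 4"
      using divide_right_mono [OF Suc, of 2] by (simp add: add_divide_distrib mult.commute)
    ultimately show ?case by simp
  qed
  have "(\<lambda>j. u K * (1 / 2) ^ j) \<longlonglongrightarrow> u K * 0"
    by (intro tendsto_intros LIMSEQ_power_zero) auto
  from LIMSEQ_D [OF this, of "e / 2"] e
  obtain L where L: "\<And>j. j \<ge> L \<Longrightarrow> \<bar>u K * (1 / 2) ^ j\<bar> < e / 2"
    by auto
  have "norm (u n - 0) < e" if "n \<ge> K + L" for n
  proof -
    obtain j where j: "n = K + j" "L \<le> j"
      using \<open>n \<ge> K + L\<close> by (auto simp: le_iff_add)
    have "u K * (1 / 2) ^ j < e / 2"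
      using L [OF j(2)] by linarith
    then have "u K / 2 ^ j < e / 2" by (simp add: power_one_over)
    then have "u n < e" using tail [of j] unfolding j(1) by linarith
    then show ?thesis using nonneg [of n] by simp
  qed
  then show "\<exists>n0. \<forall>n\<ge>n0. norm (u n - 0) < e" by blast
qed

section \<open>Sets of density zero along a sequence\<close>

definition density_along :: "(nat \<Rightarrow> nat) \<Rightarrow> nat set \<Rightarrow> nat \<Rightarrow> real" where
  "density_along N A k = real (card (A \<inter> {..<N k})) / real (N k)"

definition null_along :: "(nat \<Rightarrow> nat) \<Rightarrow> nat set set" where
  "null_along N = {A. density_along N A \<longlonglongrightarrow> 0}"

lemma density_along_nonneg [simp]: "0 \<le> density_along N A k"
  by (simp add: density_along_def)

lemma density_along_mono: "A \<subseteq> B \<Longrightarrow> density_along N A k \<le> density_along N B k"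
  unfolding density_along_def by (intro divide_right_mono) (auto intro!: card_mono)

locale doubling_sequence =
  fixes N :: "nat \<Rightarrow> nat"
  assumes N_0_pos: "0 < N 0"
    and doubling: "2 * N k \<le> N (Suc k)"
begin

lemma N_pos [simp]: "0 < N k"
proof (induction k)
  case (Suc k)
  then show ?case using doubling [of k] by linarith
qed (rule N_0_pos)

lemma N_neq_0 [simp]: "N k \<noteq> 0"
  by (metis N_pos less_not_refl)

lemma strict_mono_N: "strict_mono N"
  unfolding strict_mono_Suc_iff
proof
  fix k show "N k < N (Suc k)"
    using doubling [of k] N_pos [of k] by linarith
qed

lemma N_le_iff [simp]: "N j \<le> N k \<longleftrightarrow> j \<le> k"
  using strict_mono_N by (rule strict_mono_less_eq)

lemma self_le_N: "k \<le> N k"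
  using strict_mono_N by (rule strict_mono_imp_increasing)

lemma filterlim_N: "filterlim (\<lambda>k. real (N k)) at_top sequentially"
  by (rule filterlim_compose [OF filterlim_real_sequentially filterlim_subseq [OF strict_mono_N]])

lemma ideal_null_along: "ideal_on_nat (null_along N)"
  unfolding ideal_on_nat_def
proof (intro conjI ballI allI impI)
  fix A B assume A: "A \<in> null_along N" and B: "B \<in> null_along N"
  have "(\<lambda>k. density_along N A k + density_along N B k) \<longlonglongrightarrow> 0"
    using tendsto_add [of "density_along N A" 0 _ "density_along N B" 0] A B
    by (simp add: null_along_def)
  moreover have "density_along N (A \<union> B) k \<le> density_along N A k + density_along N B k" for k
    unfolding density_along_def Int_Un_distrib2 add_divide_distrib [symmetric] of_nat_add [symmetric]
    by (intro divide_right_mono of_nat_mono card_Un_le) auto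
  ultimately show "A \<union> B \<in> null_along N"
    unfolding null_along_def mem_Collect_eq
    by (elim tendsto_0_squeeze) auto
next
  fix A B assume "A \<in> null_along N" and "B \<subseteq> A"
  then show "B \<in> null_along N"
    unfolding null_along_def mem_Collect_eq
    by (elim tendsto_0_squeeze) (auto intro!: always_eventually density_along_mono)
next
  have "density_along N UNIV = (\<lambda>_. 1)"
    by (simp add: density_along_def fun_eq_iff)
  then have "UNIV \<notin> null_along N"
    by (simp add: null_along_def LIMSEQ_const_iff)
  then show "null_along N \<noteq> UNIV" by blast
next
  fix A :: "nat set" assume "finite A"
  have "(\<lambda>k. real (card A) / real (N k)) \<longlonglongrightarrow> 0"
    by (rule real_tendsto_divide_at_top [OF tendsto_const filterlim_N])
  moreover have "density_along N A k \<le> real (card A) / real (N k)" for k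
    unfolding density_along_def using \<open>finite A\<close>
    by (intro divide_right_mono of_nat_mono card_mono) auto
  ultimately show "A \<in> null_along N"
    unfolding null_along_def mem_Collect_eq
    by (elim tendsto_0_squeeze) auto
qed

section \<open>The associated simple density ideal\<close>

definition next_index :: "nat \<Rightarrow> nat" where
  "next_index n = (LEAST k. n \<le> N k)"

text \<open>
  A Galois connection between indices and positions; all facts about blocks below are read off
  from it.
\<close>

lemma next_index_le_iff: "next_index n \<le> k \<longleftrightarrow> n \<le> N k"
proof
  assume "next_index n \<le> k"
  moreover have "n \<le> N (next_index n)"
    unfolding next_index_def by (rule LeastI [of _ n]) (rule self_le_N)
  ultimately show "n \<le> N k" using N_le_iff le_trans by blast
qed (simp add: next_index_def Least_le)

lemma le_N_next_index: "n \<le> N (next_index n)"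
  by (simp flip: next_index_le_iff)

lemma next_index_N [simp]: "next_index (N k) = k"
proof (rule antisym)
  show "k \<le> next_index (N k)"
    using le_N_next_index [of "N k"] by simp
qed (simp add: next_index_le_iff)

lemma next_index_mono: "m \<le> n \<Longrightarrow> next_index m \<le> next_index n"
  using le_N_next_index [of n] by (simp add: next_index_le_iff)

lemma filterlim_next_index: "filterlim next_index at_top sequentially"
  unfolding filterlim_at_top eventually_sequentially
  by (metis next_index_N next_index_mono)

text \<open>
  The function \<open>g\<close> rounds \<open>n\<close> up to the next term of \<open>N\<close>. Along \<open>N\<close> itself the quotients are
  exactly the densities, and between two terms they are dominated by the density at the upper one;
  \<open>n / g n\<close> does not tend to \<open>0\<close> because it equals \<open>1\<close> along \<open>N\<close>.
\<close>

lemma simple_density_null_along: "simple_density_ideal (null_along N)"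
proof -
  define g where "g n = real (N (next_index n))" for n
  have g_N: "g (N k) = N k" for k by (simp add: g_def)
  have subseq: "filterlim N sequentially sequentially"
    by (rule filterlim_subseq [OF strict_mono_N])
  have "null_along N = simple_density_family g"
  proof (intro set_eqI iffI)
    fix A assume "A \<in> null_along N"
    then have "(\<lambda>n. density_along N A (next_index n)) \<longlonglongrightarrow> 0"
      using filterlim_compose [OF _ filterlim_next_index] by (auto simp: null_along_def)
    moreover have "real (card (A \<inter> {..<n})) / g n \<le> density_along N A (next_index n)" for n
      unfolding density_along_def g_def using le_N_next_index [of n]
      by (intro divide_right_mono of_nat_mono card_mono) auto
    moreover have "0 \<le> real (card (A \<inter> {..<n})) / g n" for n
      by (simp add: g_def)
    ultimately show "A \<in> simple_density_family g"
      unfolding simple_density_family_def mem_Collect_eq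
      by (elim tendsto_0_squeeze) auto
  next
    fix A assume "A \<in> simple_density_family g"
    then show "A \<in> null_along N"
      using filterlim_compose [OF _ subseq]
      by (fastforce simp: simple_density_family_def null_along_def density_along_def [abs_def] g_N)
  qed
  moreover have "filterlim g at_top sequentially"
    unfolding g_def by (rule filterlim_compose [OF filterlim_N filterlim_next_index])
  moreover have "\<not> (\<lambda>n. real n / g n) \<longlonglongrightarrow> 0"
  proof
    assume "(\<lambda>n. real n / g n) \<longlonglongrightarrow> 0"
    from filterlim_compose [OF this subseq] show False
      by (simp add: g_N LIMSEQ_const_iff)
  qed
  ultimately show ?thesis
    unfolding simple_density_ideal_def using ideal_null_along
    by (intro conjI exI [of _ g]) (simp_all add: g_def)
qed

section \<open>The associated Erdos-Ulam ideal\<close>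

text \<open>
  The weight is constant on blocks: for \<open>N (k - 1) \<le> i < N k\<close> it is \<open>2 ^ k / N k\<close>,
  and for \<open>i < N 0\<close> it is \<open>1 / N 0\<close>. The successor
  turns the condition \<open>Suc i \<le> N k\<close> expressed by \<^const>\<open>next_index\<close> into \<open>i < N k\<close>.
\<close>

definition weight :: "nat \<Rightarrow> real" where
  "weight i = 2 ^ next_index (Suc i) / N (next_index (Suc i))"

definition mass :: "nat set \<Rightarrow> nat \<Rightarrow> real" where
  "mass A n = (\<Sum>i\<in>A \<inter> {..<n}. weight i)"

lemma weight_nonneg: "0 \<le> weight i"
  by (simp add: weight_def)

lemma mass_nonneg: "0 \<le> mass A n"
  unfolding mass_def by (intro sum_nonneg weight_nonneg)

lemma mass_mono: "m \<le> n \<Longrightarrow> mass A m \<le> mass A n"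
  unfolding mass_def by (intro sum_mono2) (auto simp: weight_nonneg)

text \<open>This is where doubling enters: it makes the weight of a point decrease from block to block.\<close>

lemma level_weight_antimono: "j \<le> k \<Longrightarrow> 2 ^ k / real (N k) \<le> 2 ^ j / real (N j)"
proof (rule lift_Suc_antimono_le [of "\<lambda>k. 2 ^ k / real (N k)"])
  fix k
  have "2 * real (N k) \<le> real (N (Suc k))" using doubling [of k] by linarith
  then show "2 ^ Suc k / real (N (Suc k)) \<le> 2 ^ k / real (N k)"
    using N_pos [of k] N_pos [of "Suc k"] by (simp add: field_simps)
qed

text \<open>
  As the weights decrease, every point below \<open>N k\<close> weighs at least as much as a point of the
  \<open>k\<close>-th block.
\<close>

lemma density_le_mass: "2 ^ k * density_along N A k \<le> mass A (N k)"
proof -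
  have "2 ^ k * density_along N A k = (\<Sum>i\<in>A \<inter> {..<N k}. 2 ^ k / real (N k))"
    by (simp add: density_along_def)
  also have "\<dots> \<le> mass A (N k)"
    unfolding mass_def weight_def
    by (intro sum_mono level_weight_antimono) (auto simp: next_index_le_iff)
  finally show ?thesis .
qed

text \<open>
  Divided by \<open>2 ^ Suc k\<close>, this is the recursion of \<open>tendsto_0_by_halving_recursion\<close>, with the density
  of the whole of \<open>A \<inter> {..<N (Suc k)}\<close> as a crude bound for the part of \<open>A\<close> in the new block.
\<close>

lemma mass_step: "mass A (N (Suc k)) \<le> mass A (N k) + 2 ^ Suc k * density_along N A (Suc k)"
proof -
  let ?B = "A \<inter> {N k..<N (Suc k)}"
  have split: "A \<inter> {..<N (Suc k)} = (A \<inter> {..<N k}) \<union> ?B"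
    using N_le_iff [of k "Suc k"] by (auto simp del: N_le_iff)
  have block: "next_index (Suc i) = Suc k" if "i \<in> ?B" for i
    using that next_index_le_iff [of "Suc i" k] next_index_le_iff [of "Suc i" "Suc k"] by auto
  have "mass A (N (Suc k)) = mass A (N k) + (\<Sum>i\<in>?B. weight i)"
    unfolding mass_def split by (rule sum.union_disjoint) auto
  also have "(\<Sum>i\<in>?B. weight i) = real (card ?B) * (2 ^ Suc k / real (N (Suc k)))"
    by (simp add: weight_def block)
  also have "\<dots> \<le> real (card (A \<inter> {..<N (Suc k)})) * (2 ^ Suc k / real (N (Suc k)))"
    by (intro mult_right_mono of_nat_mono card_mono) auto
  finally show ?thesis by (simp add: density_along_def mult.commute)
qed

text \<open>
  For \<open>n\<close> in block \<open>Suc k\<close> the earlier blocks alone have mass at least \<open>2 ^ k\<close>. Losing only a factor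
  of \<open>2\<close> inside a block is the reason why the block masses may not grow faster than geometrically.
\<close>

lemma total_mass_ge:
  assumes "0 < next_index n"
  shows "2 ^ next_index n / 2 \<le> mass UNIV n"
proof -
  obtain k where k: "next_index n = Suc k" using assms gr0_implies_Suc by blast
  then have "N k \<le> n" using next_index_le_iff [of n k] by simp
  have "2 ^ next_index n / 2 = 2 ^ k * density_along N UNIV k"
    by (simp add: k density_along_def)
  also have "\<dots> \<le> mass UNIV (N k)" by (rule density_le_mass)
  also have "\<dots> \<le> mass UNIV n" by (rule mass_mono) fact
  finally show ?thesis .
qed

lemma total_mass_le: "mass UNIV (N k) \<le> 2 * 2 ^ k"
proof (induction k)
  case 0
  have "weight i = 1 / real (N 0)" if "i < N 0" for i
    using that next_index_le_iff [of "Suc i" 0] by (simp add: weight_def)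
  then show ?case by (simp add: mass_def)
next
  case (Suc k)
  then show ?case using mass_step [of UNIV k] by (simp add: density_along_def)
qed

lemma eventually_next_index_pos: "eventually (\<lambda>n. 0 < next_index n) sequentially"
  using eventually_compose_filterlim [OF eventually_gt_at_top filterlim_next_index] .

text \<open>
  Relative masses and densities are compared through \<open>mass A (N k) / 2 ^ k\<close>: by \<open>total_mass_ge\<close> and
  \<open>total_mass_le\<close> the total mass up to \<open>n\<close> is of the order of \<open>2 ^ next_index n\<close>.
\<close>

lemma erdos_ulam_null_along: "erdos_ulam_ideal (null_along N)"
proof -
  have sum_weight: "(\<Sum>i<n. weight i) = mass UNIV n" for n
    by (simp add: mass_def)
  have "filterlim (\<lambda>k. 1 / 2 * 2 ^ k :: real) at_top sequentially"
    by (rule filterlim_const_mult_power) simp_all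
  from filterlim_compose [OF this filterlim_next_index]
  have "filterlim (\<lambda>n. 2 ^ next_index n / 2 :: real) at_top sequentially" by simp
  then have "filterlim (\<lambda>n. \<Sum>i<n. weight i) at_top sequentially"
    unfolding sum_weight
    by (rule filterlim_at_top_mono) (use eventually_next_index_pos total_mass_ge in \<open>auto elim: eventually_mono\<close>)
  moreover have "(\<lambda>n. weight n / (\<Sum>i\<le>n. weight i)) \<longlonglongrightarrow> 0"
  proof (rule tendsto_0_squeeze)
    have "(\<lambda>n. 2 / real (N (next_index n))) \<longlonglongrightarrow> 0"
      by (rule real_tendsto_divide_at_top [OF tendsto_const
            filterlim_compose [OF filterlim_N filterlim_next_index]])
    then show "(\<lambda>n. 2 / real (N (next_index (Suc n)))) \<longlonglongrightarrow> 0"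
      by (rule LIMSEQ_Suc)
    show "0 \<le> weight n / (\<Sum>i\<le>n. weight i)" for n
      by (simp add: weight_nonneg sum_nonneg)
    have "eventually (\<lambda>n. 0 < next_index (Suc n)) sequentially"
      using eventually_next_index_pos by (rule eventually_sequentially_Suc [THEN iffD2])
    then show "eventually (\<lambda>n. weight n / (\<Sum>i\<le>n. weight i) \<le> 2 / real (N (next_index (Suc n)))) sequentially"
    proof eventually_elim
      case (elim n)
      have "weight n / mass UNIV (Suc n) \<le> weight n / (2 ^ next_index (Suc n) / 2)"
        by (rule frac_le [OF weight_nonneg order_refl _ total_mass_ge [OF elim]]) simp
      moreover have "(\<Sum>i\<le>n. weight i) = mass UNIV (Suc n)"
        by (simp add: mass_def lessThan_Suc_atMost)
      ultimately show ?case by (simp add: weight_def)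
    qed
  qed
  moreover have "null_along N = erdos_ulam_family weight"
  proof (intro set_eqI iffI)
    fix A assume "A \<in> null_along N"
    then have d: "density_along N A \<longlonglongrightarrow> 0" by (simp add: null_along_def)
    have "(\<lambda>k. mass A (N k) / 2 ^ k) \<longlonglongrightarrow> 0"
    proof (rule tendsto_0_by_halving_recursion [OF _ _ d])
      fix k
      show "mass A (N (Suc k)) / 2 ^ Suc k \<le> mass A (N k) / 2 ^ k / 2 + density_along N A (Suc k)"
        using mass_step [of A k] by (simp add: field_simps)
    qed (simp add: mass_nonneg)
    from filterlim_compose [OF this filterlim_next_index]
    have "(\<lambda>n. 2 * (mass A (N (next_index n)) / 2 ^ next_index n)) \<longlonglongrightarrow> 0"
      using tendsto_mult_right_zero by blast
    moreover have "eventually (\<lambda>n. mass A n / mass UNIV n \<le>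
        2 * (mass A (N (next_index n)) / 2 ^ next_index n)) sequentially"
      using eventually_next_index_pos
    proof eventually_elim
      case (elim n)
      have "mass A n / mass UNIV n \<le> mass A (N (next_index n)) / (2 ^ next_index n / 2)"
        using total_mass_ge [OF elim]
        by (intro frac_le) (auto simp: mass_nonneg intro: mass_mono le_N_next_index)
      then show ?case by (simp add: mult.commute)
    qed
    ultimately have "(\<lambda>n. mass A n / mass UNIV n) \<longlonglongrightarrow> 0"
      by (elim tendsto_0_squeeze) (auto simp: mass_nonneg)
    then show "A \<in> erdos_ulam_family weight"
      by (simp add: erdos_ulam_family_def sum_weight flip: mass_def)
  next
    fix A assume "A \<in> erdos_ulam_family weight"
    then have "(\<lambda>n. mass A n / mass UNIV n) \<longlonglongrightarrow> 0"
      by (simp add: erdos_ulam_family_def sum_weight flip: mass_def)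
    from filterlim_compose [OF this filterlim_subseq [OF strict_mono_N]]
    have "(\<lambda>k. 2 * (mass A (N k) / mass UNIV (N k))) \<longlonglongrightarrow> 0"
      using tendsto_mult_right_zero by blast
    moreover have "density_along N A k \<le> 2 * (mass A (N k) / mass UNIV (N k))" for k
    proof -
      have "0 < mass UNIV (N k)"
        using density_le_mass [of k UNIV] by (simp add: density_along_def) (smt (verit) zero_less_power)
      then have "2 ^ k * density_along N A k / (2 * 2 ^ k) \<le> mass A (N k) / mass UNIV (N k)"
        by (intro frac_le density_le_mass total_mass_le mass_nonneg)
      then show ?thesis by (simp add: mult.commute)
    qed
    ultimately show "A \<in> null_along N"
      unfolding null_along_def mem_Collect_eq
      by (elim tendsto_0_squeeze) auto
  qed
  ultimately show ?thesis
    unfolding erdos_ulam_ideal_def using ideal_null_along weight_nonneg by blast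
qed

end

section \<open>Incomparability\<close>

text \<open>
  Given a bijection \<open>\<phi>\<close>, the witness is \<open>\<phi> ` B\<close>, where \<open>B\<close> collects for every \<open>k\<close> the points
  \<open>x < fact (b k)\<close> that \<open>\<phi>\<close> does not move below \<open>fact (b k - 1)\<close>. By injectivity at most the
  fraction \<open>1 / b k\<close> of the segment is lost, so \<open>B\<close> has density tending to \<open>1\<close> along \<open>fact \<circ> b\<close>.
  A point \<open>\<phi> x < fact (a l)\<close> of the image comes from some \<open>k\<close> with \<open>fact (b k - 1) < fact (a l)\<close>,
  hence \<open>b k \<le> a l\<close>; as \<open>a l\<close> is not a value of \<open>b\<close> this improves to \<open>b k \<le> a l - 1\<close>, which leaves
  only the \<open>fact (a l - 1)\<close> candidates \<open>x < fact (a l - 1)\<close>, the fraction \<open>1 / a l\<close> of the segment.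
\<close>

lemma not_ideal_below_factorials:
  fixes a b :: "nat \<Rightarrow> nat"
  assumes a: "strict_mono a" and b: "strict_mono b"
    and avoid: "eventually (\<lambda>l. a l \<notin> range b) sequentially"
  shows "\<not> ideal_below (null_along (\<lambda>k. fact (a k))) (null_along (\<lambda>k. fact (b k)))"
proof
  assume "ideal_below (null_along (\<lambda>k. fact (a k))) (null_along (\<lambda>k. fact (b k)))"
  then obtain \<phi> :: "nat \<Rightarrow> nat" where \<phi>: "bij \<phi>"
    and below: "\<And>A. A \<in> null_along (\<lambda>k. fact (a k)) \<Longrightarrow> \<phi> -` A \<in> null_along (\<lambda>k. fact (b k))"
    unfolding ideal_below_def by blast
  have inv_tendsto_0: "(\<lambda>l. 1 / real (c l)) \<longlonglongrightarrow> 0" if "strict_mono c" for c :: "nat \<Rightarrow> nat"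
    by (rule real_tendsto_divide_at_top [OF tendsto_const
          filterlim_compose [OF filterlim_real_sequentially filterlim_subseq [OF that]]])
  have pos: "eventually (\<lambda>l. 0 < c l) sequentially" if "strict_mono c" for c :: "nat \<Rightarrow> nat"
    using eventually_compose_filterlim [OF eventually_gt_at_top filterlim_subseq [OF that]] .
  define B where "B = {x. \<exists>k. x < fact (b k) \<and> fact (b k - 1) \<le> \<phi> x}"
  have "\<phi> ` B \<in> null_along (\<lambda>k. fact (a k))"
    unfolding null_along_def mem_Collect_eq
  proof (rule tendsto_0_squeeze [OF inv_tendsto_0 [OF a]])
    show "eventually (\<lambda>l. density_along (\<lambda>k. fact (a k)) (\<phi> ` B) l \<le> 1 / real (a l)) sequentially"
      using avoid pos [OF a]
    proof eventually_elim
      case (elim l)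
      have "\<phi> ` B \<inter> {..<fact (a l)} \<subseteq> \<phi> ` {..<fact (a l - 1)}"
      proof
        fix y assume "y \<in> \<phi> ` B \<inter> {..<fact (a l)}"
        then obtain x k where x: "y = \<phi> x" "x < fact (b k)" "fact (b k - 1) \<le> \<phi> x" "\<phi> x < fact (a l)"
          by (auto simp: B_def)
        have "b k - 1 < a l"
          using x fact_mono_nat [of "a l" "b k - 1"] by linarith
        then have "b k \<le> a l - 1"
          using elim by (metis Suc_pred' diff_Suc_1 leI le_less_Suc_eq less_Suc_eq_le less_nat_zero_code range_eqI)
        then have "x < fact (a l - 1)"
          using x fact_mono_nat [of "b k" "a l - 1"] by linarith
        with x show "y \<in> \<phi> ` {..<fact (a l - 1)}" by blast
      qed
      then have "card (\<phi> ` B \<inter> {..<fact (a l)}) \<le> fact (a l - 1)"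
        by (metis card_image_le card_lessThan card_mono finite_imageI finite_lessThan le_trans)
      then have "real (card (\<phi> ` B \<inter> {..<fact (a l)})) \<le> real (fact (a l - 1))"
        by (rule of_nat_mono)
      moreover have "real (fact (a l)) = real (a l) * real (fact (a l - 1))"
        using elim fact_reduce [of "a l", where ?'a = real] by simp
      ultimately show ?case
        using elim by (simp add: density_along_def divide_simps mult.commute mult_left_mono)
    qed
  qed simp
  then have "\<phi> -` (\<phi> ` B) \<in> null_along (\<lambda>k. fact (b k))" by (rule below)
  then have "density_along (\<lambda>k. fact (b k)) B \<longlonglongrightarrow> 0"
    using \<phi> by (simp add: null_along_def inj_vimage_image_eq bij_is_inj)
  from tendsto_add [OF this inv_tendsto_0 [OF b]]
  have "(\<lambda>k. density_along (\<lambda>k. fact (b k)) B k + 1 / real (b k)) \<longlonglongrightarrow> 0" by simp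
  moreover have "eventually (\<lambda>k. 1 \<le> density_along (\<lambda>k. fact (b k)) B k + 1 / real (b k)) sequentially"
    using pos [OF b]
  proof eventually_elim
    case (elim k)
    let ?C = "{..<fact (b k)} \<inter> \<phi> -` {..<fact (b k - 1)}"
    have "card ?C \<le> card (\<phi> ` ?C)"
      using \<phi> by (simp add: card_image inj_on_subset [OF bij_is_inj])
    also have "\<dots> \<le> card {..<fact (b k - 1) :: nat}"
      by (rule card_mono) auto
    finally have C: "card ?C \<le> fact (b k - 1)" by simp
    have "{..<fact (b k)} \<subseteq> (B \<inter> {..<fact (b k)}) \<union> ?C"
      by (auto simp: B_def not_less)
    then have "fact (b k) \<le> card ((B \<inter> {..<fact (b k)}) \<union> ?C)"
      by (metis card_lessThan card_mono finite_Int finite_Un finite_lessThan)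
    also have "\<dots> \<le> card (B \<inter> {..<fact (b k)}) + card ?C" by (rule card_Un_le)
    finally have "fact (b k) \<le> card (B \<inter> {..<fact (b k)}) + fact (b k - 1)" using C by linarith
    then have "real (fact (b k)) \<le> real (card (B \<inter> {..<fact (b k)})) + real (fact (b k - 1))"
      by (metis of_nat_add of_nat_mono)
    moreover have "real (fact (b k)) = real (b k) * real (fact (b k - 1))"
      using elim fact_reduce [of "b k", where ?'a = real] by simp
    moreover have "0 < real (fact (b k - 1))" by simp
    ultimately show ?case
      using elim by (simp add: density_along_def field_simps)
  qed
  ultimately have "1 \<le> (0 :: real)"
    by (rule tendsto_lowerbound) simp
  then show False by simp
qed

section \<open>Continuum many almost disjoint sequences\<close>

definition base4_prefix :: "real \<Rightarrow> nat \<Rightarrow> nat" where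
  "base4_prefix r k = nat \<lfloor>4 ^ k * r\<rfloor>"

lemma base4_prefix_bounds:
  assumes "1 < r" "r < 2"
  shows "4 ^ k \<le> base4_prefix r k" and "base4_prefix r k < 2 * 4 ^ k"
proof -
  have "(4::real) ^ k \<le> 4 ^ k * r" "4 ^ k * r < 2 * 4 ^ k"
    using assms by simp_all
  then have "(4::int) ^ k \<le> \<lfloor>4 ^ k * r\<rfloor>" "\<lfloor>4 ^ k * r\<rfloor> < 2 * 4 ^ k"
    by (simp_all add: le_floor_iff floor_less_iff)
  moreover from this have "int (base4_prefix r k) = \<lfloor>4 ^ k * r\<rfloor>"
    unfolding base4_prefix_def by (smt (verit) nat_0_le zero_le_power)
  ultimately have "int (4 ^ k) \<le> int (base4_prefix r k)" "int (base4_prefix r k) < int (2 * 4 ^ k)"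
    by simp_all
  then show "4 ^ k \<le> base4_prefix r k" and "base4_prefix r k < 2 * 4 ^ k"
    by (simp_all only: of_nat_le_iff of_nat_less_iff)
qed

lemma strict_mono_base4_prefix: "1 < r \<Longrightarrow> r < 2 \<Longrightarrow> strict_mono (base4_prefix r)"
  unfolding strict_mono_Suc_iff
proof
  fix k assume r: "1 < r" "r < 2"
  show "base4_prefix r k < base4_prefix r (Suc k)"
    using base4_prefix_bounds(2) [OF r, of k] base4_prefix_bounds(1) [OF r, of "Suc k"] by simp
qed

text \<open>
  A prefix determines its length, since \<open>4 ^ k \<le> base4_prefix r k < 4 ^ Suc k\<close>.
\<close>

lemma base4_prefix_eqD:
  assumes r: "1 < r" "r < 2" and s: "1 < s" "s < 2" and eq: "base4_prefix r j = base4_prefix s k"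
  shows "j = k"
proof (rule ccontr)
  assume "j \<noteq> k"
  then consider "Suc j \<le> k" | "Suc k \<le> j" by linarith
  then show False
  proof cases
    case 1
    then have "(4::nat) ^ Suc j \<le> 4 ^ k" by (intro power_increasing) auto
    then show False using base4_prefix_bounds(2) [OF r, of j] base4_prefix_bounds(1) [OF s, of k] eq by simp
  next
    case 2
    then have "(4::nat) ^ Suc k \<le> 4 ^ j" by (intro power_increasing) auto
    then show False using base4_prefix_bounds(2) [OF s, of k] base4_prefix_bounds(1) [OF r, of j] eq by simp
  qed
qed

text \<open>
  Common values can only occur at equal positions, and the prefixes at position \<open>l\<close> differ as soon as
  \<open>4 ^ l * r\<close> and \<open>4 ^ l * s\<close> are at least \<open>1\<close> apart.
\<close>

lemma eventually_base4_prefix_notin_range: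
  assumes r: "1 < r" "r < 2" and s: "1 < s" "s < 2" and "r \<noteq> s"
  shows "eventually (\<lambda>l. base4_prefix r l \<notin> range (base4_prefix s)) sequentially"
proof -
  have "filterlim (\<lambda>l. \<bar>r - s\<bar> * 4 ^ l) at_top sequentially"
    by (rule filterlim_const_mult_power) (use \<open>r \<noteq> s\<close> in simp_all)
  then have "eventually (\<lambda>l. 1 \<le> \<bar>r - s\<bar> * 4 ^ l) sequentially"
    by (simp add: filterlim_at_top)
  then show ?thesis
  proof eventually_elim
    case (elim l)
    have "base4_prefix r l \<noteq> base4_prefix s l"
    proof
      assume "base4_prefix r l = base4_prefix s l"
      moreover have "0 \<le> \<lfloor>4 ^ l * r\<rfloor>" "0 \<le> \<lfloor>4 ^ l * s\<rfloor>" using r s by auto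
      ultimately have "\<lfloor>4 ^ l * r\<rfloor> = \<lfloor>4 ^ l * s\<rfloor>" by (metis base4_prefix_def eq_nat_nat_iff)
      then have "\<bar>4 ^ l * r - 4 ^ l * s\<bar> < 1" by linarith
      moreover have "\<bar>4 ^ l * r - 4 ^ l * s\<bar> = \<bar>r - s\<bar> * 4 ^ l"
        by (simp add: abs_mult flip: right_diff_distrib)
      ultimately show False using elim by linarith
    qed
    then show ?case using base4_prefix_eqD [OF r s] by blast
  qed
qed

lemma doubling_fact_base4_prefix:
  assumes r: "1 < r" "r < 2"
  shows "doubling_sequence (\<lambda>k. fact (base4_prefix r k))"
proof
  fix k
  have "base4_prefix r k \<le> base4_prefix r (Suc k) - 1"
    using strict_mono_base4_prefix [OF r] by (metis Suc_pred' lessI less_Suc_eq_le less_zeroE neq0_conv strict_mono_less)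
  then have "(fact (base4_prefix r k) :: nat) \<le> fact (base4_prefix r (Suc k) - 1)" by (rule fact_mono_nat)
  moreover have "2 \<le> base4_prefix r (Suc k)"
    using base4_prefix_bounds(1) [OF r, of "Suc k"] by (rule order_trans [rotated]) simp
  ultimately have "2 * (fact (base4_prefix r k) :: nat) \<le> base4_prefix r (Suc k) * fact (base4_prefix r (Suc k) - 1)"
    by (intro mult_mono) auto
  also have "\<dots> = fact (base4_prefix r (Suc k))"
    using \<open>2 \<le> base4_prefix r (Suc k)\<close> by (subst (2) fact_reduce) auto
  finally show "2 * (fact (base4_prefix r k) :: nat) \<le> fact (base4_prefix r (Suc k))" .
qed simp

section \<open>The antichain\<close>

theorem proposition6:
  shows "\<exists>F :: nat set set set.
           ideal_antichain F \<and>
           F \<approx> (UNIV :: real set) \<and>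
           (\<forall>I\<in>F. erdos_ulam_ideal I \<and> simple_density_ideal I)"
proof -
  \<comment> \<open>an injection of the real line into the interval \<open>{1<..<2}\<close>\<close>
  define h :: "real \<Rightarrow> real" where "h x = 1 + 1 / (1 + exp x)" for x
  have h: "1 < h x" "h x < 2" for x
    using exp_gt_zero [of x] by (auto simp: h_def field_simps simp del: exp_gt_zero)
  have h_inj: "h x \<noteq> h y" if "x \<noteq> y" for x y
  proof
    assume "h x = h y"
    moreover have "0 < 1 + exp x" "0 < 1 + exp y" by (simp_all add: add_pos_pos)
    ultimately show False using that by (simp add: h_def divide_simps algebra_simps split: if_splits)
  qed
  define D where "D x = null_along (\<lambda>k. fact (base4_prefix (h x) k))" for x
  have incomparable: "\<not> ideal_below (D x) (D y)" if "x \<noteq> y" for x y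
    unfolding D_def
    by (intro not_ideal_below_factorials strict_mono_base4_prefix eventually_base4_prefix_notin_range h h_inj that)
  have refl: "ideal_below I I" for I
    unfolding ideal_below_def by (intro exI [of _ id]) auto
  \<comment> \<open>incomparability already makes the ideals distinct, every ideal being below itself\<close>
  have "inj D"
    using incomparable refl by (metis injI)
  then have "range D \<approx> (UNIV :: real set)"
    by (rule inj_on_image_eqpoll_self)
  moreover have "ideal_antichain (range D)"
    unfolding ideal_antichain_def
  proof (intro conjI ballI impI)
    fix I assume "I \<in> range D"
    then show "ideal_on_nat I"
      using doubling_sequence.ideal_null_along [OF doubling_fact_base4_prefix [OF h]]
      by (auto simp: D_def)
  next
    fix I J assume "I \<in> range D" "J \<in> range D" "I \<noteq> J"
    then obtain x y where "I = D x" "J = D y" "x \<noteq> y" by blast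
    then show "\<not> ideal_below I J" "\<not> ideal_below J I"
      using incomparable by simp_all
  qed
  moreover have "\<forall>I\<in>range D. erdos_ulam_ideal I \<and> simple_density_ideal I"
    using doubling_sequence.erdos_ulam_null_along [OF doubling_fact_base4_prefix [OF h]]
      doubling_sequence.simple_density_null_along [OF doubling_fact_base4_prefix [OF h]]
    by (auto simp: D_def)
  ultimately show ?thesis by blast
qed

end
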